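(* Let $J$ be a nonempty finite index set and let $(u_j)_{j\in J}$ be a family of vectors in $\mathbb{R}^n$. There exist $N\in\mathbb{N}$ and $\delta_0>0$, depending only on $(u_j)_{j\in J}$, such that for every $\delta\in(0,\delta_0)$ and all nonnegative real coefficients $(d_j)_{j\in J}$, $$\inf_{|y|\leq N\log(1/\delta)}\ \sum_{j\in J}d_j\exp(\langle u_j,y\rangle)\ \leq\ \inf_{y\in\mathbb{R}^n}\ \sum_{j\in J}d_j\exp(\langle u_j,y\rangle)+\delta\max_{j\in J}d_j.$$
   Context: $\langle\cdot,\cdot\rangle$ and $|\cdot|$ are the euclidean inner product and norm on $\mathbb{R}^n$; the first infimum is over $y\in\mathbb{R}^n$ with $|y|\le N\log(1/\delta)$. *)

theory Defs
  imports "HOL-Analysis.Analysis"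
begin

end

theory Submission
  imports Defs
begin

text \<open>
  Put \<open>f y = (\<Sum>j\<in>J. d j * exp (u j \<bullet> y))\<close> and \<open>L = 2 * ln (1 / \<delta>)\<close>.  It suffices to replace an
  arbitrary \<open>y\<close> by a point \<open>y'\<close> of norm \<open>O(L)\<close> such that \<open>u j \<bullet> y' \<le> max (u j \<bullet> y) (- L)\<close> for
  all \<open>j\<close>: each summand of \<open>f\<close> then grows by at most \<open>d j * exp (- L) = d j * \<delta>\<^sup>2\<close>, which
  adds up to at most \<open>\<delta> * Max (d ` J)\<close> as soon as \<open>card J * \<delta> \<le> 1\<close>.  The coefficients
  no longer matter: what remains is a Hoffman-type bound for a system of linear inequalities
  (lemma \<open>truncation\<close>), whose constant must depend on the vectors \<open>u j\<close> only.

  The bound rests on conformal decompositions (lemma \<open>finite_conformal_generators\<close>).  The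
  hyperplanes orthogonal to the \<open>u j\<close> cut the space into finitely many cones, and there is a
  finite set \<open>E\<close> such that every \<open>y\<close> is a combination \<open>\<Sum>e. t e *\<^sub>R e\<close> with \<open>t e \<ge> 0\<close> and
  with each \<open>e \<in> E\<close> that occurs in the same closed cone as \<open>y\<close>.  Now cut every coefficient
  \<open>t e\<close> down to \<open>min (t e) K\<close>, where \<open>K\<close> is a large multiple of \<open>L\<close>.  The result has norm
  \<open>O(K)\<close>.  No sign cancellation occurs in \<open>u j \<bullet> y = (\<Sum>e. t e * (u j \<bullet> e))\<close>, so a
  nonnegative value only decreases, while a negative value either stays unchanged or retains a
  summand with coefficient \<open>K\<close>, which alone brings it below \<open>- L\<close>.

  The generators come from the double description method: \<open>E\<close> starts as the positive and negative
  coordinate vectors, and whenever a new hyperplane \<open>a \<bullet> x = 0\<close> is introduced, the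
  intersections of this hyperplane with the planar cones spanned by two old generators are added
  (lemma \<open>mem_convex_cone_hull_refine\<close>).
\<close>

section \<open>Finitely generated cones\<close>

lemma convex_cone_hull_finite_obtain:
  fixes T :: "'a::real_vector set"
  assumes "finite T" and "y \<in> convex_cone hull T"
  obtains t where "\<And>e. t e \<ge> 0" "y = (\<Sum>e\<in>T. t e *\<^sub>R e)"
proof -
  let ?P = "\<lambda>y. \<exists>t. (\<forall>e. t e \<ge> (0::real)) \<and> y = (\<Sum>e\<in>T. t e *\<^sub>R e)"
  have "?P y"
  proof (rule hull_induct[OF assms(2), where P = ?P])
    fix x assume x: "x \<in> T"
    have "(\<Sum>e\<in>T. (if e = x then 1 else 0::real) *\<^sub>R e) = (\<Sum>e\<in>T. if e = x then e else 0)"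
      by (rule sum.cong) auto
    also have "\<dots> = x" using x assms(1) by simp
    finally show "?P x"
      by (intro exI[of _ "\<lambda>e. if e = x then 1 else 0"]) auto
  next
    have "?P 0"
      by (intro exI[of _ "\<lambda>_. 0"]) auto
    moreover have "?P (v + w)" if v: "?P v" and w: "?P w" for v w
    proof -
      obtain s t where "\<forall>e. s e \<ge> 0" "v = (\<Sum>e\<in>T. s e *\<^sub>R e)"
        "\<forall>e. t e \<ge> 0" "w = (\<Sum>e\<in>T. t e *\<^sub>R e)"
        using v w by blast
      then show ?thesis
        by (intro exI[of _ "\<lambda>e. s e + t e"]) (auto simp: scaleR_add_left sum.distrib)
    qed
    moreover have "?P (c *\<^sub>R v)" if v: "?P v" and c: "c \<ge> 0" for c v
    proof -
      obtain s where "\<forall>e. s e \<ge> 0" "v = (\<Sum>e\<in>T. s e *\<^sub>R e)"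
        using v by blast
      with c show ?thesis
        by (intro exI[of _ "\<lambda>e. c * s e"]) (auto simp: scaleR_sum_right)
    qed
    ultimately show "convex_cone {y. ?P y}"
      unfolding convex_cone_iff by blast
  qed
  then show ?thesis using that by blast
qed

lemma convex_cone_hull_signed_Basis:
  "y \<in> convex_cone hull (Basis \<union> uminus ` Basis)" (is "_ \<in> ?H")
  for y :: "'a::euclidean_space"
proof -
  have term_in: "(y \<bullet> b) *\<^sub>R b \<in> ?H" if b: "b \<in> Basis" for b
  proof (cases "y \<bullet> b \<ge> 0")
    case True
    then show ?thesis
      using b by (intro convex_cone_hull_mul hull_inc) auto
  next
    case False
    have "(- (y \<bullet> b)) *\<^sub>R (- b) \<in> ?H"
      using b False by (intro convex_cone_hull_mul hull_inc) auto
    then show ?thesis by simp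
  qed
  have "(\<Sum>b\<in>B. (y \<bullet> b) *\<^sub>R b) \<in> ?H" if "finite B" "B \<subseteq> Basis" for B
    using that by (induction B)
      (auto intro!: convex_cone_hull_add term_in simp: convex_cone_hull_contains_0)
  from this[of Basis] show ?thesis
    by (simp add: euclidean_representation)
qed

lemma convex_cone_hull_pos_half:
  fixes a :: "'a::real_inner"
  assumes "p \<in> convex_cone hull S" and "\<And>e. e \<in> S \<Longrightarrow> a \<bullet> e > 0"
  shows "p = 0 \<or> a \<bullet> p > 0"
  using assms(1)
proof (rule hull_induct)
  show "convex_cone {x. x = 0 \<or> a \<bullet> x > 0}"
    by (auto simp: convex_cone_iff inner_simps less_le)
qed (use assms(2) in auto)

text \<open>
  For \<open>a \<bullet> e > 0 > a \<bullet> f\<close> the vector \<open>(a \<bullet> e) *\<^sub>R f - (a \<bullet> f) *\<^sub>R e\<close> spans the ray in which the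
  hyperplane orthogonal to \<open>a\<close> meets the cone spanned by \<open>e\<close> and \<open>f\<close>.  The expression is bilinear,
  so a cone that contains it for all generators of two cones contains it for all of their points.
\<close>

lemma convex_cone_hull_bilinear:
  fixes a :: "'a::real_inner"
  assumes p: "p \<in> convex_cone hull P" and n: "n \<in> convex_cone hull Q"
    and ef: "\<And>e f. e \<in> P \<Longrightarrow> f \<in> Q \<Longrightarrow> (a \<bullet> e) *\<^sub>R f - (a \<bullet> f) *\<^sub>R e \<in> convex_cone hull T"
  shows "(a \<bullet> p) *\<^sub>R n - (a \<bullet> n) *\<^sub>R p \<in> convex_cone hull T"
proof -
  have cone: "convex_cone {x. g x \<in> convex_cone hull T}" if "linear g" for g :: "'a \<Rightarrow> 'a"
    using that
    by (auto simp: convex_cone_iff linear_0 linear_add linear_cmul convex_cone_hull_contains_0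
        intro: convex_cone_hull_add convex_cone_hull_mul)
  have "(a \<bullet> e) *\<^sub>R n - (a \<bullet> n) *\<^sub>R e \<in> convex_cone hull T" if "e \<in> P" for e
    using n
  proof (rule hull_induct)
    show "convex_cone {x. (a \<bullet> e) *\<^sub>R x - (a \<bullet> x) *\<^sub>R e \<in> convex_cone hull T}"
      by (rule cone) (auto intro!: linearI simp: algebra_simps inner_simps)
  qed (use that ef in auto)
  with p show ?thesis
  proof (rule hull_induct)
    show "convex_cone {x. (a \<bullet> x) *\<^sub>R n - (a \<bullet> n) *\<^sub>R x \<in> convex_cone hull T}"
      by (rule cone) (auto intro!: linearI simp: algebra_simps inner_simps)
  qed
qed

text \<open>
  One step of the double description method, for all three possible signs of \<open>a \<bullet> y\<close> at once: the
  generators off the hyperplane orthogonal to \<open>a\<close> that are not on the side of \<open>y\<close> can be traded for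
  generators on that hyperplane.  Collect the parts \<open>p\<close> and \<open>n\<close> of \<open>y\<close> on the positive and the negative
  side.  The smaller one, say \<open>n\<close>, is absorbed by the fraction \<open>- (a \<bullet> n) / (a \<bullet> p)\<close> of \<open>p\<close>: this
  sum lies on the hyperplane, and the rest of \<open>p\<close> is on the correct side.
\<close>

lemma mem_convex_cone_hull_refine:
  fixes a :: "'a::real_inner"
  assumes y: "y \<in> convex_cone hull S"
    and zero: "\<And>e. e \<in> S \<Longrightarrow> a \<bullet> e = 0 \<Longrightarrow> e \<in> T"
    and pos: "\<And>e. e \<in> S \<Longrightarrow> a \<bullet> e > 0 \<Longrightarrow> a \<bullet> y > 0 \<Longrightarrow> e \<in> T"
    and neg: "\<And>e. e \<in> S \<Longrightarrow> a \<bullet> e < 0 \<Longrightarrow> a \<bullet> y < 0 \<Longrightarrow> e \<in> T"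
    and mix: "\<And>e f. e \<in> S \<Longrightarrow> f \<in> S \<Longrightarrow> a \<bullet> e > 0 \<Longrightarrow> a \<bullet> f < 0 \<Longrightarrow>
                (a \<bullet> e) *\<^sub>R f - (a \<bullet> f) *\<^sub>R e \<in> T"
  shows "y \<in> convex_cone hull T"
proof -
  define Z where "Z = {e\<in>S. a \<bullet> e = 0}"
  define P where "P = {e\<in>S. a \<bullet> e > 0}"
  define Q where "Q = {e\<in>S. a \<bullet> e < 0}"
  have "S = Z \<union> (P \<union> Q)"
    by (auto simp: Z_def P_def Q_def)
  with y obtain z p n where z: "z \<in> convex_cone hull Z" and p: "p \<in> convex_cone hull P"
    and n: "n \<in> convex_cone hull Q" and y_eq: "y = z + (p + n)"
    by (auto simp: convex_cone_hull_Un)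
  have z0: "a \<bullet> z = 0"
    using z by (rule hull_induct) (auto simp: Z_def convex_cone_iff inner_simps)
  have p0: "p = 0 \<or> a \<bullet> p > 0"
    using p by (rule convex_cone_hull_pos_half) (auto simp: P_def)
  have n0: "n = 0 \<or> a \<bullet> n < 0"
    using convex_cone_hull_pos_half[OF n, of "- a"] by (auto simp: Q_def)
  have zT: "z \<in> convex_cone hull T"
    using z zero hull_mono[of Z T convex_cone] by (auto simp: Z_def)
  have pT: "p \<in> convex_cone hull T" if "a \<bullet> y > 0"
    using p pos that hull_mono[of P T convex_cone] by (auto simp: P_def)
  have nT: "n \<in> convex_cone hull T" if "a \<bullet> y < 0"
    using n neg that hull_mono[of Q T convex_cone] by (auto simp: Q_def)
  have mT: "(a \<bullet> p) *\<^sub>R n - (a \<bullet> n) *\<^sub>R p \<in> convex_cone hull T" (is "?m \<in> _")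
    using p n by (rule convex_cone_hull_bilinear) (auto simp: P_def Q_def intro!: hull_inc mix)
  have ay: "a \<bullet> y = a \<bullet> p + a \<bullet> n"
    using z0 by (simp add: y_eq inner_simps)
  have "p + n \<in> convex_cone hull T"
  proof (cases "p = 0 \<or> n = 0")
    case True
    then show ?thesis
      using p0 n0 pT nT ay by (auto simp: convex_cone_hull_contains_0)
  next
    case False
    then have pp: "a \<bullet> p > 0" and nn: "a \<bullet> n < 0"
      using p0 n0 by auto
    consider "a \<bullet> y = 0" | "a \<bullet> y > 0" | "a \<bullet> y < 0" by linarith
    then show ?thesis
    proof cases
      case 1
      then have "p + n = (1 / (a \<bullet> p)) *\<^sub>R ?m"
        using pp ay by (simp add: algebra_simps eq_neg_iff_add_eq_0[symmetric])
      also have "\<dots> \<in> convex_cone hull T"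
        using mT pp by (intro convex_cone_hull_mul) auto
      finally show ?thesis .
    next
      case 2
      have "p + n = ((a \<bullet> y) / (a \<bullet> p)) *\<^sub>R p + (1 / (a \<bullet> p)) *\<^sub>R ?m"
        using pp by (simp add: ay algebra_simps add_divide_distrib)
      also have "\<dots> \<in> convex_cone hull T"
        using mT pp pT 2 by (intro convex_cone_hull_add convex_cone_hull_mul) auto
      finally show ?thesis .
    next
      case 3
      have "p + n = ((a \<bullet> y) / (a \<bullet> n)) *\<^sub>R n + (1 / - (a \<bullet> n)) *\<^sub>R ?m"
        using nn by (simp add: ay algebra_simps add_divide_distrib)
      also have "\<dots> \<in> convex_cone hull T"
        using mT nn nT 3
        by (intro convex_cone_hull_add convex_cone_hull_mul) (auto simp: divide_nonpos_neg)
      finally show ?thesis .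
    qed
  qed
  with zT show ?thesis
    unfolding y_eq by (rule convex_cone_hull_add)
qed

section \<open>Conformal decompositions\<close>

text \<open>
  In covector language: \<open>e\<close> lies in the closure of the cell of \<open>y\<close> in the arrangement of the
  hyperplanes orthogonal to the \<open>u j\<close>.  In particular \<open>u j \<bullet> y = 0\<close> forces \<open>u j \<bullet> e = 0\<close>, which
  the condition \<open>(u j \<bullet> e) * (u j \<bullet> y) \<ge> 0\<close> would not do.
\<close>

definition conformal :: "('j \<Rightarrow> 'a::real_inner) \<Rightarrow> 'j set \<Rightarrow> 'a \<Rightarrow> 'a \<Rightarrow> bool" where
  "conformal u J y e \<longleftrightarrow>
    (\<forall>j\<in>J. (u j \<bullet> y \<ge> 0 \<longrightarrow> u j \<bullet> e \<ge> 0) \<and> (u j \<bullet> y \<le> 0 \<longrightarrow> u j \<bullet> e \<le> 0))"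

lemma conformal_insert:
  "conformal u (insert i J) y e \<longleftrightarrow>
    (u i \<bullet> y \<ge> 0 \<longrightarrow> u i \<bullet> e \<ge> 0) \<and> (u i \<bullet> y \<le> 0 \<longrightarrow> u i \<bullet> e \<le> 0) \<and> conformal u J y e"
  by (auto simp: conformal_def)

lemma conformal_diff:
  assumes "conformal u J y e" "conformal u J y f" "\<alpha> \<ge> 0" "\<beta> \<le> 0"
  shows "conformal u J y (\<alpha> *\<^sub>R f - \<beta> *\<^sub>R e)"
proof -
  have "\<alpha> * (u j \<bullet> f) - \<beta> * (u j \<bullet> e) \<ge> 0" if "u j \<bullet> f \<ge> 0" "u j \<bullet> e \<ge> 0" for j
    using that assms(3,4) mult_nonneg_nonneg[of \<alpha> "u j \<bullet> f"] mult_nonpos_nonneg[of \<beta> "u j \<bullet> e"]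
    by linarith
  moreover have "\<alpha> * (u j \<bullet> f) - \<beta> * (u j \<bullet> e) \<le> 0" if "u j \<bullet> f \<le> 0" "u j \<bullet> e \<le> 0" for j
    using that assms(3,4) mult_nonneg_nonpos[of \<alpha> "u j \<bullet> f"] mult_nonpos_nonpos[of \<beta> "u j \<bullet> e"]
    by linarith
  ultimately show ?thesis
    using assms(1,2) unfolding conformal_def by (simp add: inner_diff_right)
qed

text \<open>
  The closed cells of the arrangement are polyhedral cones, and all of them are generated by parts
  of a single finite set; this is the direction of the Minkowski-Weyl theorem that produces
  generators from inequalities.
\<close>

lemma finite_conformal_generators:
  fixes u :: "'j \<Rightarrow> 'a::euclidean_space"
  assumes "finite J"
  shows "\<exists>E. finite E \<and> (\<forall>y. y \<in> convex_cone hull {e\<in>E. conformal u J y e})"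
  using assms
proof (induction J)
  case empty
  show ?case
    by (intro exI[of _ "Basis \<union> uminus ` Basis"])
      (use convex_cone_hull_signed_Basis in \<open>auto simp: conformal_def Un_def image_iff\<close>)
next
  case (insert i J)
  then obtain E where E: "finite E" "\<And>y. y \<in> convex_cone hull {e\<in>E. conformal u J y e}"
    by blast
  \<comment> \<open>Pairs on the same side of the new hyperplane contribute superfluous vectors; those that do not
      fit \<open>y\<close> are discarded by the conformality condition.\<close>
  define E' where "E' = E \<union> (\<lambda>(e, f). (u i \<bullet> e) *\<^sub>R f - (u i \<bullet> f) *\<^sub>R e) ` (E \<times> E)"
  have "y \<in> convex_cone hull {e\<in>E'. conformal u (insert i J) y e}" for y
  proof (rule mem_convex_cone_hull_refine[OF E(2)[of y], of "u i"])
    fix e f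
    assume "e \<in> {e\<in>E. conformal u J y e}" "f \<in> {e\<in>E. conformal u J y e}"
      and "u i \<bullet> e > 0" "u i \<bullet> f < 0"
    then show "(u i \<bullet> e) *\<^sub>R f - (u i \<bullet> f) *\<^sub>R e \<in> {e\<in>E'. conformal u (insert i J) y e}"
      by (auto simp: E'_def conformal_insert inner_diff_right intro: conformal_diff)
  qed (auto simp: E'_def conformal_insert)
  moreover have "finite E'"
    using E(1) by (simp add: E'_def)
  ultimately show ?case by blast
qed

section \<open>Truncation of solutions of linear inequalities\<close>

text \<open>
  Equivalently: a consistent system \<open>u j \<bullet> x \<le> b j\<close> with all \<open>b j \<ge> - L\<close>, where \<open>L \<ge> 0\<close>, has a
  solution of norm at most \<open>C * L\<close>.  The bound does not involve the size of positive \<open>b j\<close>, since the origin satisfies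
  those inequalities.
\<close>

lemma truncation:
  fixes u :: "'j \<Rightarrow> 'a::euclidean_space"
  assumes "finite J"
  shows "\<exists>C\<ge>0. \<forall>y. \<forall>L\<ge>0. \<exists>y'. norm y' \<le> C * L \<and> (\<forall>j\<in>J. u j \<bullet> y' \<le> max (u j \<bullet> y) (- L))"
proof -
  obtain E where fin: "finite E" and E: "\<And>y. y \<in> convex_cone hull {e\<in>E. conformal u J y e}"
    using finite_conformal_generators[OF assms, of u] by blast
  \<comment> \<open>Inserting 1 makes the set nonempty, so that its minimum is meaningful in every case.\<close>
  define V where "V = insert 1 ((\<lambda>(j, e). \<bar>u j \<bullet> e\<bar>) ` (J \<times> E) - {0})"
  define \<epsilon> where "\<epsilon> = Min V"
  have finV: "finite V" "V \<noteq> {}"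
    using assms fin by (auto simp: V_def)
  have \<epsilon>: "\<epsilon> > 0"
    unfolding \<epsilon>_def using finV by (subst Min_gr_iff) (auto simp: V_def)
  have \<epsilon>_le: "\<epsilon> \<le> \<bar>u j \<bullet> e\<bar>" if "j \<in> J" "e \<in> E" "u j \<bullet> e \<noteq> 0" for j e
    unfolding \<epsilon>_def using finV that by (intro Min_le) (auto simp: V_def)
  define C where "C = (\<Sum>e\<in>E. norm e) / \<epsilon>"
  have "\<exists>y'. norm y' \<le> C * L \<and> (\<forall>j\<in>J. u j \<bullet> y' \<le> max (u j \<bullet> y) (- L))" if L: "L \<ge> 0" for y L
  proof -
    define T where "T = {e\<in>E. conformal u J y e}"
    have finT: "finite T" and TE: "T \<subseteq> E"
      using fin by (auto simp: T_def)
    obtain t where t: "\<And>e. t e \<ge> 0" and y: "y = (\<Sum>e\<in>T. t e *\<^sub>R e)"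
      using convex_cone_hull_finite_obtain[OF finT E[of y, folded T_def]] by blast
    define K where "K = L / \<epsilon>"
    have K: "K \<ge> 0"
      using L \<epsilon> by (simp add: K_def)
    define y' where "y' = (\<Sum>e\<in>T. min (t e) K *\<^sub>R e)"
    have uy: "u j \<bullet> y = (\<Sum>e\<in>T. t e * (u j \<bullet> e))" for j
      by (simp add: y inner_sum_right)
    have uy': "u j \<bullet> y' = (\<Sum>e\<in>T. min (t e) K * (u j \<bullet> e))" for j
      by (simp add: y'_def inner_sum_right)
    have "norm y' \<le> (\<Sum>e\<in>T. norm (min (t e) K *\<^sub>R e))"
      unfolding y'_def by (rule norm_sum)
    also have "\<dots> \<le> (\<Sum>e\<in>T. K * norm e)"
      using t K by (intro sum_mono) (auto simp: min_def intro!: mult_right_mono)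
    also have "\<dots> \<le> (\<Sum>e\<in>E. K * norm e)"
      using fin TE K by (intro sum_mono2) auto
    also have "\<dots> = C * L"
      unfolding sum_distrib_left[symmetric] by (simp add: K_def C_def)
    finally have norm_le: "norm y' \<le> C * L" .
    have "u j \<bullet> y' \<le> max (u j \<bullet> y) (- L)" if j: "j \<in> J" for j
    proof (cases "u j \<bullet> y \<ge> 0")
      case True
      then have "u j \<bullet> e \<ge> 0" if "e \<in> T" for e
        using that j by (auto simp: T_def conformal_def)
      then have "u j \<bullet> y' \<le> u j \<bullet> y"
        unfolding uy uy' by (intro sum_mono mult_right_mono) auto
      then show ?thesis by simp
    next
      case False
      then have nonpos: "u j \<bullet> e \<le> 0" if "e \<in> T" for e
        using that j by (auto simp: T_def conformal_def)
      show ?thesis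
      proof (cases "\<exists>e\<in>T. u j \<bullet> e \<noteq> 0 \<and> K < t e")
        case True
        then obtain e where e: "e \<in> T" "u j \<bullet> e \<noteq> 0" "K < t e" by blast
        have "\<epsilon> \<le> - (u j \<bullet> e)"
          using \<epsilon>_le[OF j, of e] e nonpos[of e] TE by auto
        then have "K * \<epsilon> \<le> K * - (u j \<bullet> e)"
          using K by (rule mult_left_mono)
        then have "K * (u j \<bullet> e) \<le> - L"
          using \<epsilon> by (simp add: K_def)
        moreover have "(\<Sum>e\<in>T - {e}. min (t e) K * (u j \<bullet> e)) \<le> 0"
          using t K nonpos by (intro sum_nonpos mult_nonneg_nonpos) auto
        moreover have "u j \<bullet> y' = K * (u j \<bullet> e) + (\<Sum>e\<in>T - {e}. min (t e) K * (u j \<bullet> e))"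
          unfolding uy' using finT e by (simp add: sum.remove[of T e])
        ultimately show ?thesis by linarith
      next
        case False
        then have "u j \<bullet> y' = u j \<bullet> y"
          unfolding uy uy' by (intro sum.cong) (auto simp: min_def not_less)
        then show ?thesis by simp
      qed
    qed
    with norm_le show ?thesis by blast
  qed
  moreover have "C \<ge> 0"
    using \<epsilon> by (auto simp: C_def intro!: divide_nonneg_pos sum_nonneg)
  ultimately show ?thesis by blast
qed

section \<open>Localising the infimum of a sum of exponentials\<close>

theorem theorem1p5:
  fixes J :: "'j set" and u :: "'j \<Rightarrow> real ^ 'n"
  assumes "finite J" and "J \<noteq> {}"
  shows "\<exists>N :: nat. \<exists>\<delta>\<^sub>0 :: real. \<delta>\<^sub>0 > 0 \<and>
    (\<forall>\<delta> \<in> {0<..<\<delta>\<^sub>0}. \<forall>d :: 'j \<Rightarrow> real. (\<forall>j\<in>J. d j \<ge> 0) \<longrightarrow>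
      (INF y\<in>{y :: real ^ 'n. norm y \<le> real N * ln (1 / \<delta>)}. \<Sum>j\<in>J. d j * exp (u j \<bullet> y))
        \<le> (INF y\<in>(UNIV :: (real ^ 'n) set). \<Sum>j\<in>J. d j * exp (u j \<bullet> y)) + \<delta> * Max (d ` J))"
proof -
  obtain C where C: "C \<ge> 0" and trunc: "\<And>y L. L \<ge> 0 \<Longrightarrow>
      \<exists>y'. norm y' \<le> C * L \<and> (\<forall>j\<in>J. u j \<bullet> y' \<le> max (u j \<bullet> y) (- L))"
    using truncation[OF assms(1), of u] by blast
  obtain N :: nat where N: "2 * C \<le> real N"
    using real_arch_simple by blast
  define m where "m = real (card J)"
  have m: "m \<ge> 1"
    using assms by (simp add: m_def Suc_le_eq card_gt_0_iff)
  show ?thesis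
  proof (intro exI[of _ N] exI[of _ "1 / m"] conjI ballI allI impI)
    show "1 / m > 0"
      using m by simp
    fix \<delta> :: real and d :: "'j \<Rightarrow> real"
    assume "\<delta> \<in> {0<..<1 / m}" and d: "\<forall>j\<in>J. d j \<ge> 0"
    then have \<delta>: "\<delta> > 0" "m * \<delta> < 1"
      using m by (auto simp: field_simps)
    have \<delta>1: "\<delta> < 1"
      using mult_right_mono[OF m less_imp_le[OF \<delta>(1)]] \<delta>(2) by linarith
    define M where "M = Max (d ` J)"
    have dM: "d j \<le> M" if "j \<in> J" for j
      using that assms(1) by (simp add: M_def)
    have M: "M \<ge> 0"
      using assms(2) d dM by (meson all_not_in_conv order_trans)
    define f where "f = (\<lambda>y. \<Sum>j\<in>J. d j * exp (u j \<bullet> y))"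
    have f_nonneg: "f y \<ge> 0" for y
      unfolding f_def using d by (intro sum_nonneg) auto
    define B where "B = {y :: real ^ 'n. norm y \<le> real N * ln (1 / \<delta>)}"
    define L where "L = 2 * ln (1 / \<delta>)"
    have ln: "ln (1 / \<delta>) \<ge> 0"
      using \<delta> \<delta>1 by simp
    then have L: "L \<ge> 0"
      by (simp add: L_def)
    have "L = - ln (\<delta>\<^sup>2)"
      using \<delta> by (simp add: L_def ln_div ln_realpow)
    then have expL: "exp (- L) = \<delta>\<^sup>2"
      using \<delta> by simp
    have "(INF y\<in>B. f y) - \<delta> * M \<le> f y" for y
    proof -
      obtain y' where y': "norm y' \<le> C * L" "\<And>j. j \<in> J \<Longrightarrow> u j \<bullet> y' \<le> max (u j \<bullet> y) (- L)"
        using trunc[OF L] by blast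
      have "C * L \<le> real N * ln (1 / \<delta>)"
        using mult_right_mono[OF N ln] by (simp add: L_def mult_ac)
      with y'(1) have "y' \<in> B"
        by (simp add: B_def)
      then have "(INF y\<in>B. f y) \<le> f y'"
        using f_nonneg by (intro cINF_lower bdd_belowI[of _ 0]) auto
      also have "f y' \<le> (\<Sum>j\<in>J. d j * exp (u j \<bullet> y) + M * \<delta>\<^sup>2)"
        unfolding f_def
      proof (rule sum_mono)
        fix j assume j: "j \<in> J"
        have "exp (u j \<bullet> y') \<le> exp (u j \<bullet> y) + exp (- L)"
        proof (cases "u j \<bullet> y \<le> - L")
          case True
          then have "exp (u j \<bullet> y') \<le> exp (- L)"
            using y'(2)[OF j] by simp
          then show ?thesis
            using exp_ge_zero[of "u j \<bullet> y"] by linarith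
        next
          case False
          then have "exp (u j \<bullet> y') \<le> exp (u j \<bullet> y)"
            using y'(2)[OF j] by simp
          then show ?thesis
            using exp_ge_zero[of "- L"] by linarith
        qed
        then have "d j * exp (u j \<bullet> y') \<le> d j * (exp (u j \<bullet> y) + \<delta>\<^sup>2)"
          using d j unfolding expL by (intro mult_left_mono) auto
        also have "\<dots> \<le> d j * exp (u j \<bullet> y) + M * \<delta>\<^sup>2"
          using dM[OF j] by (simp add: distrib_left mult_right_mono)
        finally show "d j * exp (u j \<bullet> y') \<le> d j * exp (u j \<bullet> y) + M * \<delta>\<^sup>2" .
      qed
      also have "\<dots> = f y + m * \<delta> * (\<delta> * M)"
        by (simp add: sum.distrib f_def m_def power2_eq_square mult_ac)
      also have "m * \<delta> * (\<delta> * M) \<le> \<delta> * M"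
        using \<delta> M m by (intro mult_left_le_one_le) auto
      finally show ?thesis by simp
    qed
    then have "(INF y\<in>B. f y) - \<delta> * M \<le> (INF y. f y)"
      by (intro cINF_greatest) auto
    then show "(INF y\<in>{y :: real ^ 'n. norm y \<le> real N * ln (1 / \<delta>)}. \<Sum>j\<in>J. d j * exp (u j \<bullet> y))
        \<le> (INF y\<in>(UNIV :: (real ^ 'n) set). \<Sum>j\<in>J. d j * exp (u j \<bullet> y)) + \<delta> * Max (d ` J)"
      unfolding B_def f_def M_def by linarith
  qed
qed

end
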